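(* Let $X,Y$ be Banach spaces and $T\in\mathcal{L}(X,Y)$. Then $uc_{1}^{6}(T)=uc(T)$.
   Context: Banach spaces are real or complex; $\mathcal{L}(X,Y)$ is the space of continuous linear maps from $X$ to $Y$. A sequence $(x_n)_n$ in $X$ is weakly $1$-summable, written $(x_n)_n\in l_1^w(X)$, if $\|(x_n)_n\|_1^w:=\sup\{\sum_{n=1}^{\infty}|\langle x^*,x_n\rangle|:x^*\in B_{X^*}\}<\infty$, where $B_{X^*}$ is the closed unit ball of $X^*$. For a bounded sequence, $ca((x_n)_n)=\inf_n\sup\{\|x_k-x_l\|:k,l\geq n\}$. Define $uc(T)=\sup\{ca((\sum_{i=1}^{n}Tx_i)_n):(x_n)_n\in l_1^w(X),\ \|(x_n)_n\|_1^w\leq 1\}$ and $uc_1^6(T)=\sup\{\limsup_n\|Tx_n\|:(x_n)_n\in l_1^w(X),\ \|(x_n)_n\|_1^w\leq 1\}$. *)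

theory Defs
  imports "HOL-Analysis.Analysis"
begin

text \<open>
  The distribution has a class \<open>banach\<close> for real Banach spaces only. To cover real and complex
  scalars at once, the scalar field is a type \<open>'k :: real_normed_field\<close> and the scalar
  multiplication is an explicit function. Both \<open>real\<close> and \<open>complex\<close> are instances, and up to
  isometric isomorphism they are the only ones, by the Gelfand-Mazur theorem (the norm of a
  \<open>real_normed_field\<close> is multiplicative). For \<open>'k = real\<close>, \<open>scale_of_real\<close> forces \<open>scale\<close> to be
  \<open>scaleR\<close>.
\<close>

locale normed_space_over = vector_space scale
  for scale :: "'k::real_normed_field \<Rightarrow> 'a::real_normed_vector \<Rightarrow> 'a" +
  assumes scale_of_real: "scale (of_real r) x = r *\<^sub>R x"
    and norm_scale: "norm (scale c x) = norm c * norm x"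

locale banach_space_over = normed_space_over scale
  for scale :: "'k::real_normed_field \<Rightarrow> 'a::banach \<Rightarrow> 'a"

lemma banach_space_over_real: "banach_space_over (scaleR :: real \<Rightarrow> 'a::banach \<Rightarrow> 'a)"
  by unfold_locales (auto simp: algebra_simps)

lemma banach_space_over_complex: "banach_space_over ((*) :: complex \<Rightarrow> complex \<Rightarrow> complex)"
  by unfold_locales (auto simp: algebra_simps norm_mult scaleR_conv_of_real)

definition continuous_linear_maps ::
  "('k::real_normed_field \<Rightarrow> 'a::real_normed_vector \<Rightarrow> 'a) \<Rightarrow>
   ('k \<Rightarrow> 'b::real_normed_vector \<Rightarrow> 'b) \<Rightarrow> ('a \<Rightarrow> 'b) set" where
  "continuous_linear_maps scaleX scaleY =
     {T. Vector_Spaces.linear scaleX scaleY T \<and> continuous_on UNIV T}"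

definition dual_unit_ball ::
  "('k::real_normed_field \<Rightarrow> 'a::real_normed_vector \<Rightarrow> 'a) \<Rightarrow> ('a \<Rightarrow> 'k) set" where
  "dual_unit_ball scaleX = {f \<in> continuous_linear_maps scaleX (*). onorm f \<le> 1}"

text \<open>
  All suprema, infima and infinite sums are taken in \<open>ereal\<close>, so that they always exist. Sequences
  are indexed from \<open>0\<close>; the partial sum up to and including the entry with index \<open>n\<close> is
  \<open>\<Sum>i\<le>n. x i\<close>.
\<close>

definition weak_l1_norm ::
  "('k::real_normed_field \<Rightarrow> 'a::real_normed_vector \<Rightarrow> 'a) \<Rightarrow> (nat \<Rightarrow> 'a) \<Rightarrow> ereal" where
  "weak_l1_norm scaleX x = (SUP f\<in>dual_unit_ball scaleX. \<Sum>n. ereal (norm (f (x n))))"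

definition weak_l1 ::
  "('k::real_normed_field \<Rightarrow> 'a::real_normed_vector \<Rightarrow> 'a) \<Rightarrow> (nat \<Rightarrow> 'a) set" where
  "weak_l1 scaleX = {x. weak_l1_norm scaleX x < \<infinity>}"

definition ca :: "(nat \<Rightarrow> 'a::real_normed_vector) \<Rightarrow> ereal" where
  "ca x = (INF n. SUP (k, l)\<in>{n..} \<times> {n..}. ereal (norm (x k - x l)))"

definition uc ::
  "('k::real_normed_field \<Rightarrow> 'a::real_normed_vector \<Rightarrow> 'a) \<Rightarrow>
   ('a \<Rightarrow> 'b::real_normed_vector) \<Rightarrow> ereal" where
  "uc scaleX T =
     (SUP x\<in>{x \<in> weak_l1 scaleX. weak_l1_norm scaleX x \<le> 1}. ca (\<lambda>n. \<Sum>i\<le>n. T (x i)))"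

definition uc16 ::
  "('k::real_normed_field \<Rightarrow> 'a::real_normed_vector \<Rightarrow> 'a) \<Rightarrow>
   ('a \<Rightarrow> 'b::real_normed_vector) \<Rightarrow> ereal" where
  "uc16 scaleX T =
     (SUP x\<in>{x \<in> weak_l1 scaleX. weak_l1_norm scaleX x \<le> 1}. limsup (\<lambda>n. ereal (norm (T (x n)))))"

end

theory Submission
  imports Defs
begin

text \<open>
  Both quantities are suprema over the same sequences \<open>x\<close>, and one inequality holds for each \<open>x\<close>
  separately: \<open>T (x n)\<close> is the difference of two consecutive partial sums, so the oscillation of
  the partial sums dominates the upper limit of \<open>norm (T (x n))\<close>
  (\<open>limsup_increments_le_ca_partial_sums\<close>).

  For the other inequality the sequence has to be changed. If the partial sums of \<open>T (x i)\<close>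
  oscillate by more than \<open>c\<close>, then successive, non-overlapping blocks of indices can be chosen over
  each of which the sum of \<open>T (x i)\<close> has norm above \<open>c\<close> (\<open>ca_partial_sums_blocks\<close>). By the triangle
  inequality, summing \<open>x\<close> over these blocks gives a sequence \<open>y\<close> whose weak 1-norm is at most that
  of \<open>x\<close> (\<open>weak_l1_norm_blocks_le\<close>). Hence \<open>y\<close> also competes in the supremum, and \<open>T (y j)\<close> has norm
  above \<open>c\<close> for every \<open>j\<close>.
\<close>

lemma continuous_linear_maps_sum:
  assumes "T \<in> continuous_linear_maps scaleX scaleY"
  shows "T (\<Sum>i\<in>I. x i) = (\<Sum>i\<in>I. T (x i))"
proof -
  interpret Vector_Spaces.linear scaleX scaleY T
    using assms by (simp add: continuous_linear_maps_def)
  show ?thesis by (rule sum)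
qed

text \<open>
  The intervals \<open>{p j..<q j}\<close> are disjoint, so the block sums of norms are part of the whole sum;
  they may be empty, and there may be gaps between them.
\<close>

lemma sum_norm_blocks_le:
  fixes g :: "nat \<Rightarrow> 'a::real_normed_vector"
  assumes "\<And>j. p j \<le> q j" and "\<And>j. q j \<le> p (Suc j)"
  shows "(\<Sum>j<N. norm (\<Sum>i=p j..<q j. g i)) \<le> (\<Sum>i<p N. norm (g i))"
proof (induction N)
  case 0
  show ?case by (simp add: sum_nonneg)
next
  case (Suc N)
  have "(\<Sum>j<Suc N. norm (\<Sum>i=p j..<q j. g i))
      \<le> (\<Sum>i<p N. norm (g i)) + (\<Sum>i=p N..<q N. norm (g i))"
    using Suc by (simp add: add_mono norm_sum)
  also have "\<dots> = (\<Sum>i<q N. norm (g i))"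
    using sum.atLeastLessThan_concat[of 0 "p N" "q N" "\<lambda>i. norm (g i)"] assms(1)[of N]
    by (simp add: atLeast0LessThan)
  also have "\<dots> \<le> (\<Sum>i<p (Suc N). norm (g i))"
    using assms(2)[of N] by (intro sum_mono2) auto
  finally show ?case .
qed

lemma weak_l1_norm_blocks_le:
  assumes "\<And>j. p j \<le> q j" and "\<And>j. q j \<le> p (Suc j)"
  shows "weak_l1_norm scaleX (\<lambda>j. \<Sum>i=p j..<q j. x i) \<le> weak_l1_norm scaleX x"
  unfolding weak_l1_norm_def
proof (rule SUP_subset_mono[OF subset_refl], rule suminf_bound, rule allI)
  fix f N
  assume "f \<in> dual_unit_ball scaleX"
  then have f_sum: "f (\<Sum>i\<in>I. x i) = (\<Sum>i\<in>I. f (x i))" for I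
    unfolding dual_unit_ball_def by (blast intro: continuous_linear_maps_sum)
  have "(\<Sum>j<N. ereal (norm (f (\<Sum>i=p j..<q j. x i))))
      \<le> (\<Sum>i<p N. ereal (norm (f (x i))))"
    using sum_norm_blocks_le[where p = p and q = q and g = "\<lambda>i. f (x i)" and N = N] assms by (simp add: f_sum)
  also have "\<dots> \<le> (\<Sum>i. ereal (norm (f (x i))))"
    by (rule sum_le_suminf) (auto simp: summable_ereal_pos)
  finally show "(\<Sum>j<N. ereal (norm (f (\<Sum>i=p j..<q j. x i))))
      \<le> (\<Sum>i. ereal (norm (f (x i))))" .
qed simp

lemma limsup_increments_le_ca_partial_sums:
  fixes u :: "nat \<Rightarrow> 'a::real_normed_vector"
  shows "limsup (\<lambda>n. ereal (norm (u n))) \<le> ca (\<lambda>n. \<Sum>i\<le>n. u i)"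
  unfolding ca_def
proof (rule INF_greatest, rule Limsup_bounded)
  fix n
  let ?S = "\<lambda>n. \<Sum>i\<le>n. u i"
  show "\<forall>\<^sub>F m in sequentially. ereal (norm (u m))
      \<le> (SUP (k, l)\<in>{n..} \<times> {n..}. ereal (norm (?S k - ?S l)))"
    using eventually_gt_at_top[of n]
  proof eventually_elim
    case (elim m)
    then obtain m' where m': "m = Suc m'" "n \<le> m'"
      by (cases m) auto
    have "ereal (norm (u m)) = ereal (norm (?S m - ?S m'))"
      using m' by simp
    also have "\<dots> \<le> (SUP (k, l)\<in>{n..} \<times> {n..}. ereal (norm (?S k - ?S l)))"
      using m' by (intro SUP_upper2[of "(m, m')"]) auto
    finally show ?case .
  qed
qed

text \<open>
  For negative \<open>c\<close> the two indices that witness the oscillation may coincide. Such a pair gives an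
  empty block, whose sum \<open>0\<close> still has norm above \<open>c\<close>, so the sign of \<open>c\<close> is immaterial.
\<close>

lemma ca_partial_sums_blocks:
  fixes u :: "nat \<Rightarrow> 'a::real_normed_vector"
  assumes "c < ca (\<lambda>n. \<Sum>i\<le>n. u i)"
  obtains p q where "\<And>j. p j \<le> q j" and "\<And>j. q j \<le> p (Suc j)"
    and "\<And>j. c < ereal (norm (\<Sum>i=p j..<q j. u i))"
proof -
  let ?S = "\<lambda>n. \<Sum>i\<le>n. u i"
  have "\<exists>k l. n \<le> k \<and> k \<le> l \<and> c < ereal (norm (?S l - ?S k))" for n
  proof -
    have "c < (SUP (k, l)\<in>{n..} \<times> {n..}. ereal (norm (?S k - ?S l)))"
      using assms unfolding ca_def by (rule less_INF_D) simp
    then obtain k l where "n \<le> k" "n \<le> l" "c < ereal (norm (?S k - ?S l))"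
      by (auto simp: less_SUP_iff)
    then show ?thesis
      by (metis nat_le_linear norm_minus_commute)
  qed
  then obtain k l where
    kl: "\<And>n. n \<le> k n" "\<And>n. k n \<le> l n" "\<And>n. c < ereal (norm (?S (l n) - ?S (k n)))"
    by metis
  \<comment> \<open>\<open>s j\<close> is the first index that the first \<open>j\<close> blocks have left free. The increment from \<open>?S k\<close> to
    \<open>?S l\<close> is the sum over \<open>{Suc k..<Suc l}\<close>, because \<open>?S k\<close> includes the entry with index \<open>k\<close>.\<close>
  define s where "s j = ((\<lambda>n. Suc (l n)) ^^ j) 0" for j
  have s_Suc: "s (Suc j) = Suc (l (s j))" for j
    by (simp add: s_def)
  have increment: "?S b - ?S a = (\<Sum>i=Suc a..<Suc b. u i)" if "a \<le> b" for a b
    using sum.atLeastLessThan_concat[of 0 "Suc a" "Suc b" u] that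
    by (simp add: atLeast0LessThan lessThan_Suc_atMost algebra_simps
        del: sum.op_ivl_Suc sum.lessThan_Suc)
  show thesis
  proof (rule that)
    fix j
    show "Suc (k (s j)) \<le> Suc (l (s j))"
      using kl(2) by simp
    show "Suc (l (s j)) \<le> Suc (k (s (Suc j)))"
      using kl(1)[of "s (Suc j)"] by (simp add: s_Suc)
    show "c < ereal (norm (\<Sum>i=Suc (k (s j))..<Suc (l (s j)). u i))"
      using kl(3)[of "s j"] unfolding increment[OF kl(2)] .
  qed
qed

theorem theorem4p4:
  fixes scaleX :: "'k::real_normed_field \<Rightarrow> 'a::banach \<Rightarrow> 'a"
    and scaleY :: "'k \<Rightarrow> 'b::banach \<Rightarrow> 'b"
    and T :: "'a \<Rightarrow> 'b"
  assumes "banach_space_over scaleX"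
    and "banach_space_over scaleY"
    and "T \<in> continuous_linear_maps scaleX scaleY"
  shows "uc16 scaleX T = uc scaleX T"
proof (rule antisym)
  show "uc16 scaleX T \<le> uc scaleX T"
    unfolding uc16_def uc_def
    by (rule SUP_mono') (rule limsup_increments_le_ca_partial_sums)
  show "uc scaleX T \<le> uc16 scaleX T"
    unfolding uc_def
  proof (rule SUP_least, rule dense_le)
    fix x c
    assume x: "x \<in> {x \<in> weak_l1 scaleX. weak_l1_norm scaleX x \<le> 1}"
      and c_less: "c < ca (\<lambda>n. \<Sum>i\<le>n. T (x i))"
    obtain p q where pq: "\<And>j. p j \<le> q j" "\<And>j. q j \<le> p (Suc j)"
      and c: "\<And>j. c < ereal (norm (\<Sum>i=p j..<q j. T (x i)))"
      using ca_partial_sums_blocks[OF c_less] by metis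
    define y where "y j = (\<Sum>i=p j..<q j. x i)" for j
    have "weak_l1_norm scaleX y \<le> weak_l1_norm scaleX x"
      unfolding y_def using pq by (rule weak_l1_norm_blocks_le)
    then have y: "y \<in> {x \<in> weak_l1 scaleX. weak_l1_norm scaleX x \<le> 1}"
      using x by (auto simp: weak_l1_def)
    have "T (y j) = (\<Sum>i=p j..<q j. T (x i))" for j
      unfolding y_def using assms(3) by (rule continuous_linear_maps_sum)
    with c have "c \<le> limsup (\<lambda>j. ereal (norm (T (y j))))"
      by (intro le_Limsup always_eventually allI) (auto simp: less_imp_le)
    also have "\<dots> \<le> uc16 scaleX T"
      unfolding uc16_def using y by (rule SUP_upper)
    finally show "c \<le> uc16 scaleX T" .
  qed
qed

end
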